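(* Let $\alpha_0,\alpha_1,\dots,\alpha_N$ be skew-symmetric forms on $\mathbb R^n$, with $\alpha_j$ of degree $k_j$, such that $\alpha=\alpha_0$ is a calibration $k$-form ($k=k_0$). Let $\mathrm{G}=\{P\in\mathrm{SO}(n):P^*\alpha_j=\alpha_j,\ 0\le j\le N\}$, and assume $\mathrm{G}$ acts transitively on the $\alpha$-calibrated $k$-planes. Suppose that for any oriented $k$-plane $W$ which is $\alpha$-calibrated, the following holds: for each $0\le j\le N$, either $$\alpha_j\in\bigoplus_{0\le 2r\le k_j}(\Lambda^{k_j-2r}W)\otimes(\Lambda^{2r}W^\perp)\quad\text{or}\quad \alpha_j\in\bigoplus_{0\le 2r+1\le k_j}(\Lambda^{k_j-(2r+1)}W)\otimes(\Lambda^{2r+1}W^\perp).$$ Then $\alpha$ is compliant.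
   Context: $\mathbb R^n$ has its standard inner product and orientation; vectors and covectors are identified, so $\Lambda^2(\mathbb R^n)=\mathfrak{so}(n)$, with its standard inner product, and for a subspace $W$, $\Lambda^m(\mathbb R^n)=\bigoplus_{p+q=m}(\Lambda^pW)\otimes(\Lambda^qW^\perp)$. For $1\le k\le n-1$, $\alpha\in\Lambda^k(\mathbb R^n)$ is a calibration if $\alpha|_W\le\mathrm{vol}_W$ for every oriented $k$-plane $W$, with equality for at least one $W$; $W$ is $\alpha$-calibrated if $\alpha|_W=\mathrm{vol}_W$. Let $\mathfrak g$ be the Lie algebra of $\mathrm{G}$. For a calibrated $W$, $\mathrm{H}_W=\{P\in\mathrm{G}:P(W)=W\}$ has Lie algebra $\mathfrak h_W=\mathfrak g\cap(\Lambda^2W\oplus\Lambda^2W^\perp)$, and $\mathfrak h_W^{\perp_{\mathfrak g}}$ is its orthogonal complement in $\mathfrak g$. $\alpha$ is compliant if $\mathfrak h_W^{\perp_{\mathfrak g}}=\mathfrak g\cap(W\otimes W^\perp)$ for the calibrated planes $W$ (given transitivity of $\mathrm{G}$ on calibrated planes this does not depend on the choice of calibrated $W$). *)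

theory Defs
  imports "HOL-Analysis.Analysis"
begin

section \<open>Exterior forms on \<open>\<real>\<^sup>n\<close>\<close>

text \<open>
  A form of degree \<open>m\<close> is a function on lists of vectors that only matters on lists of
  length \<open>m\<close>; it is normalised to vanish on all other lists, so that equality of forms is
  equality of functions. The degree may thus vary within a statement, while the dimension
  \<open>n = CARD('n)\<close> is arbitrary but fixed.
\<close>

type_synonym 'n form = "(real ^ 'n) list \<Rightarrow> real"

definition alternating_form :: "nat \<Rightarrow> 'n::finite form \<Rightarrow> bool" where
  "alternating_form m \<alpha> \<longleftrightarrow>
     (\<forall>vs i. length vs = m \<and> i < m \<longrightarrow> linear (\<lambda>x. \<alpha> (vs[i := x]))) \<and>
     (\<forall>vs i j. length vs = m \<and> i < j \<and> j < m \<and> vs ! i = vs ! j \<longrightarrow> \<alpha> vs = 0) \<and>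
     (\<forall>vs. length vs \<noteq> m \<longrightarrow> \<alpha> vs = 0)"

definition pullback :: "real ^ 'n ^ 'n \<Rightarrow> 'n::finite form \<Rightarrow> 'n form" where
  "pullback P \<alpha> = (\<lambda>vs. \<alpha> (map (\<lambda>v. P *v v) vs))"

text \<open>
  \<open>wedge [w\<^sub>1, \<dots>, w\<^sub>m]\<close> is \<open>w\<^sub>1 \<and> \<dots> \<and> w\<^sub>m\<close>, vectors being identified with covectors; its value at
  \<open>[v\<^sub>1, \<dots>, v\<^sub>m]\<close> is the determinant of the matrix of inner products of \<open>w\<^sub>i\<close> with \<open>v\<^sub>j\<close>
  (no factor \<open>1/m!\<close>).
\<close>

definition wedge :: "(real ^ 'n) list \<Rightarrow> 'n::finite form" where
  "wedge ws = (\<lambda>vs. if length vs = length ws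
     then \<Sum>p | p permutes {..<length ws}. of_int (sign p) * (\<Prod>i<length ws. ws ! i \<bullet> vs ! p i)
     else 0)"

text \<open>
  \<open>bigraded W p q\<close> is \<open>(\<Lambda>\<^sup>p W) \<otimes> (\<Lambda>\<^sup>q W\<^sup>\<bottom>)\<close> inside \<open>\<Lambda>\<^sup>p\<^sup>+\<^sup>q(\<real>\<^sup>n)\<close>: the linear span of the products
  \<open>w\<^sub>1 \<and> \<dots> \<and> w\<^sub>p \<and> u\<^sub>1 \<and> \<dots> \<and> u\<^sub>q\<close> with all \<open>w\<^sub>i \<in> W\<close> and all \<open>u\<^sub>i \<in> W\<^sup>\<bottom>\<close>.
\<close>

definition bigraded :: "(real ^ 'n) set \<Rightarrow> nat \<Rightarrow> nat \<Rightarrow> 'n::finite form set" where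
  "bigraded W p q =
     {\<lambda>vs. \<Sum>i<N. c i * wedge (ws i @ us i) vs | (N::nat) c ws us.
        \<forall>i<N. length (ws i) = p \<and> set (ws i) \<subseteq> W \<and> length (us i) = q \<and> set (us i) \<subseteq> W\<^sup>\<bottom>}"

text \<open>The sum of the \<open>(\<Lambda>\<^sup>m\<^sup>-\<^sup>q W) \<otimes> (\<Lambda>\<^sup>q W\<^sup>\<bottom>)\<close> over \<open>q \<le> m\<close> with \<open>Q q\<close>.\<close>

definition bigraded_sum :: "(real ^ 'n) set \<Rightarrow> nat \<Rightarrow> (nat \<Rightarrow> bool) \<Rightarrow> 'n::finite form set" where
  "bigraded_sum W m Q =
     {\<lambda>vs. \<Sum>q | q \<le> m \<and> Q q. \<beta> q vs | \<beta>. \<forall>q. q \<le> m \<and> Q q \<longrightarrow> \<beta> q \<in> bigraded W (m - q) q}"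


section \<open>Oriented planes and calibrations\<close>

text \<open>
  An oriented \<open>m\<close>-plane is a pair of an \<open>m\<close>-dimensional subspace \<open>W\<close> and its volume form
  \<open>vol = e\<^sub>1 \<and> \<dots> \<and> e\<^sub>m\<close>, where \<open>e\<^sub>1, \<dots>, e\<^sub>m\<close> is an orthonormal basis of \<open>W\<close>. For \<open>m \<ge> 1\<close> there are
  exactly two choices of \<open>vol\<close>, which are the two orientations of \<open>W\<close>; an ordered basis of \<open>W\<close>
  is positively oriented iff \<open>vol\<close> is positive on it.
\<close>

definition oriented_plane :: "nat \<Rightarrow> (real ^ 'n) set \<Rightarrow> 'n::finite form \<Rightarrow> bool" where
  "oriented_plane m W vol \<longleftrightarrow>
     (\<exists>es. length es = m \<and> span (set es) = W \<and>
        (\<forall>i<m. \<forall>j<m. es ! i \<bullet> es ! j = (if i = j then 1 else 0)) \<and> vol = wedge es)"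

definition calibrated :: "nat \<Rightarrow> 'n form \<Rightarrow> (real ^ 'n) set \<Rightarrow> 'n::finite form \<Rightarrow> bool" where
  "calibrated k \<alpha> W vol \<longleftrightarrow>
     oriented_plane k W vol \<and> (\<forall>vs. length vs = k \<and> set vs \<subseteq> W \<longrightarrow> \<alpha> vs = vol vs)"

text \<open>
  On the oriented line \<open>\<Lambda>\<^sup>k W\<^sup>*\<close>, the inequality \<open>\<alpha>|W \<le> vol\<close> means inequality on positively
  oriented bases of \<open>W\<close>.
\<close>

definition calibration :: "nat \<Rightarrow> 'n::finite form \<Rightarrow> bool" where
  "calibration k \<alpha> \<longleftrightarrow>
     1 \<le> k \<and> k \<le> CARD('n) - 1 \<and> alternating_form k \<alpha> \<and>
     (\<forall>W vol. oriented_plane k W vol \<longrightarrow>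
        (\<forall>vs. length vs = k \<and> set vs \<subseteq> W \<and> 0 < vol vs \<longrightarrow> \<alpha> vs \<le> vol vs)) \<and>
     (\<exists>W vol. calibrated k \<alpha> W vol)"


section \<open>Stabilisers, Lie algebras and compliance\<close>

definition form_stabilizer :: "nat \<Rightarrow> (nat \<Rightarrow> 'n::finite form) \<Rightarrow> (real ^ 'n ^ 'n) set" where
  "form_stabilizer N \<alpha> = {P. rotation_matrix P \<and> (\<forall>j\<le>N. pullback P (\<alpha> j) = \<alpha> j)}"

text \<open>
  \<open>P\<close> carries the oriented plane \<open>(W, vol)\<close> to \<open>(W', vol')\<close> iff it maps \<open>W\<close> onto \<open>W'\<close> and pulls
  \<open>vol'\<close> back to \<open>vol\<close>.
\<close>

definition transitive_on_calibrated ::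
    "nat \<Rightarrow> 'n::finite form \<Rightarrow> (real ^ 'n ^ 'n) set \<Rightarrow> bool" where
  "transitive_on_calibrated k \<alpha> G \<longleftrightarrow>
     (\<forall>W vol W' vol'. calibrated k \<alpha> W vol \<and> calibrated k \<alpha> W' vol' \<longrightarrow>
        (\<exists>P\<in>G. (\<lambda>v. P *v v) ` W = W' \<and> pullback P vol' = vol))"

text \<open>
  The Lie algebra of a closed matrix group, as its tangent space at the identity: all velocities
  at the identity of continuously differentiable curves lying in the group.
\<close>

definition lie_algebra :: "(real ^ 'n ^ 'n) set \<Rightarrow> (real ^ 'n ^ 'n::finite) set" where
  "lie_algebra G =
     {A. \<exists>\<gamma>. \<gamma> C1_differentiable_on UNIV \<and> range \<gamma> \<subseteq> G \<and> \<gamma> 0 = mat 1 \<and>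
          (\<gamma> has_vector_derivative A) (at 0)}"

definition plane_stabilizer ::
    "(real ^ 'n ^ 'n) set \<Rightarrow> (real ^ 'n) set \<Rightarrow> (real ^ 'n ^ 'n::finite) set" where
  "plane_stabilizer G W = {P \<in> G. (\<lambda>v. P *v v) ` W = W}"

text \<open>
  The identification of \<open>so(n)\<close> with \<open>\<Lambda>\<^sup>2(\<real>\<^sup>n)\<close>, under which \<open>u \<and> v\<close> is
  \<open>x \<mapsto> (u \<bullet> x) v - (v \<bullet> x) u\<close>. The opposite sign convention would lead to the same subspaces.
\<close>

definition two_form :: "real ^ 'n ^ 'n \<Rightarrow> 'n::finite form" where
  "two_form A = (\<lambda>vs. if length vs = 2 then (A *v vs ! 0) \<bullet> vs ! 1 else 0)"

text \<open>
  The inner product of \<open>\<Lambda>\<^sup>2(\<real>\<^sup>n)\<close> for which the \<open>e\<^sub>i \<and> e\<^sub>j\<close> with \<open>i < j\<close> are orthonormal, that is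
  \<open>- tr (A B) / 2\<close> on skew-symmetric matrices.
\<close>

definition so_inner :: "real ^ 'n ^ 'n \<Rightarrow> real ^ 'n ^ 'n \<Rightarrow> real" where
  "so_inner A B = (A \<bullet> (B :: real ^ 'n ^ 'n::finite)) / 2"

definition so_complement_in ::
    "(real ^ 'n ^ 'n) set \<Rightarrow> (real ^ 'n ^ 'n) set \<Rightarrow> (real ^ 'n ^ 'n::finite) set" where
  "so_complement_in \<gg> \<hh> = {A \<in> \<gg>. \<forall>B\<in>\<hh>. so_inner A B = 0}"

definition compliant :: "nat \<Rightarrow> 'n::finite form \<Rightarrow> (real ^ 'n ^ 'n) set \<Rightarrow> bool" where
  "compliant k \<alpha> G \<longleftrightarrow>
     (\<forall>W vol. calibrated k \<alpha> W vol \<longrightarrow>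
        so_complement_in (lie_algebra G) (lie_algebra (plane_stabilizer G W)) =
        {A \<in> lie_algebra G. two_form A \<in> bigraded W 1 1})"

end

theory Submission
  imports Defs
begin

text \<open>
  Let \<open>R\<close> be the reflection that is \<open>1\<close> on \<open>W\<close> and \<open>-1\<close> on \<open>W\<^sup>\<bottom>\<close>. It acts on
  \<open>(\<Lambda>\<^sup>p W) \<otimes> (\<Lambda>\<^sup>q W\<^sup>\<bottom>)\<close> as \<open>(-1)\<^sup>q\<close>, so the parity hypothesis says that \<open>R\<close> preserves every
  \<open>\<alpha>\<^sub>j\<close> up to sign. Hence conjugation by \<open>R\<close> preserves the group and its Lie algebra \<open>\<gg>\<close>, which
  splits into the \<open>1\<close>-eigenspace, which is \<open>\<hh>\<close>, and the \<open>-1\<close>-eigenspace, which is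
  \<open>\<gg> \<inter> (W \<otimes> W\<^sup>\<bottom>)\<close>; the two are orthogonal. That every fixed \<open>A \<in> \<gg>\<close> lies in \<open>\<hh>\<close> is seen from
  the curve \<open>exp(tA)\<close>, which commutes with \<open>R\<close> and stays in the group.
\<close>

section \<open>The matrix exponential\<close>

lemma bounded_bilinear_matrix_mult:
  "bounded_bilinear ((**) :: real^'n^'m \<Rightarrow> real^'k^'n \<Rightarrow> real^'k^'m)"
proof -
  have "bilinear ((**) :: real^'n^'m \<Rightarrow> real^'k^'n \<Rightarrow> real^'k^'m)"
    unfolding bilinear_def
    by (intro conjI allI linearI)
       (simp_all add: vec_eq_iff matrix_matrix_mult_def sum_distrib_left distrib_left
          distrib_right sum.distrib mult_ac)
  then show ?thesis
    by (simp add: bilinear_conv_bounded_bilinear)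
qed

interpretation matrix_mult: bounded_bilinear "(**) :: real^'n^'m \<Rightarrow> real^'k^'n \<Rightarrow> real^'k^'m"
  by (rule bounded_bilinear_matrix_mult)

definition matrix_power :: "real^'n^'n \<Rightarrow> nat \<Rightarrow> real^'n^'n::finite" where
  "matrix_power A m = (((**) A) ^^ m) (mat 1)"

text \<open>This is \<open>exp (t A)\<close>, written entry by entry as a real power series in
  \<open>t\<close>, so that convergence and termwise differentiation reduce to the scalar
  case.\<close>

definition matrix_exp :: "real^'n^'n \<Rightarrow> real \<Rightarrow> real^'n^'n::finite" where
  "matrix_exp A t = (\<chi> i j. \<Sum>m. matrix_power A m $ i $ j / fact m * t ^ m)"

lemma matrix_power_0: "matrix_power A 0 = mat 1"
  by (simp add: matrix_power_def)

lemma matrix_power_Suc: "matrix_power A (Suc m) = A ** matrix_power A m"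
  by (simp add: matrix_power_def)

lemma matrix_power_commute:
  assumes "A ** R = R ** A"
  shows "matrix_power A m ** R = R ** matrix_power A m"
proof (induction m)
  case (Suc m)
  then show ?case by (metis assms matrix_mul_assoc matrix_power_Suc)
qed (simp add: matrix_power_0)

text \<open>The sum \<open>?C\<close> of all absolute entries dominates every row sum of
  \<open>A\<close>, so each further factor \<open>A\<close> costs at most one factor
  \<open>?C\<close>. The exponential series is then dominated by a scalar one.\<close>

lemma matrix_power_entry_bound:
  "\<bar>matrix_power A m $ i $ j\<bar> \<le> (\<Sum>i\<in>UNIV. \<Sum>k\<in>UNIV. \<bar>A $ i $ k\<bar>) ^ m"
proof (induction m arbitrary: i)
  case 0
  then show ?case by (simp add: matrix_power_0 mat_def)
next
  case (Suc m)
  let ?C = "\<Sum>i\<in>UNIV. \<Sum>k\<in>UNIV. \<bar>A $ i $ k\<bar>"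
  have "\<bar>matrix_power A (Suc m) $ i $ j\<bar> \<le> (\<Sum>k\<in>UNIV. \<bar>A $ i $ k\<bar> * \<bar>matrix_power A m $ k $ j\<bar>)"
    by (simp add: matrix_power_Suc matrix_matrix_mult_def)
       (metis (no_types, lifting) abs_mult sum_abs sum.cong)
  also have "\<dots> \<le> (\<Sum>k\<in>UNIV. \<bar>A $ i $ k\<bar> * ?C ^ m)"
    by (intro sum_mono mult_left_mono Suc.IH) auto
  also have "\<dots> = (\<Sum>k\<in>UNIV. \<bar>A $ i $ k\<bar>) * ?C ^ m"
    by (simp add: sum_distrib_right)
  also have "\<dots> \<le> ?C * ?C ^ m"
    by (intro mult_right_mono member_le_sum[of i UNIV "\<lambda>i. \<Sum>k\<in>UNIV. \<bar>A $ i $ k\<bar>"])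
       (auto intro!: sum_nonneg zero_le_power)
  finally show ?case by simp
qed

lemma summable_matrix_exp: "summable (\<lambda>m. matrix_power A m $ i $ j / fact m * t ^ m)"
proof (rule summable_comparison_test')
  let ?C = "\<Sum>i\<in>UNIV. \<Sum>k\<in>UNIV. \<bar>A $ i $ k\<bar>"
  show "summable (\<lambda>m. inverse (fact m) * (?C * \<bar>t\<bar>) ^ m)"
    by (rule summable_exp)
  fix m :: nat
  have "\<bar>matrix_power A m $ i $ j\<bar> * \<bar>t\<bar> ^ m / fact m \<le> ?C ^ m * \<bar>t\<bar> ^ m / fact m"
    by (intro divide_right_mono mult_right_mono matrix_power_entry_bound) auto
  then show "norm (matrix_power A m $ i $ j / fact m * t ^ m) \<le> inverse (fact m) * (?C * \<bar>t\<bar>) ^ m"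
    by (simp add: abs_mult power_abs power_mult_distrib field_simps)
qed

lemma has_vector_derivative_vec_lambda:
  fixes f :: "real \<Rightarrow> 'a::real_normed_vector ^ 'n::finite"
  assumes "\<And>i. ((\<lambda>t. f t $ i) has_vector_derivative f' $ i) F"
  shows "(f has_vector_derivative f') F"
proof -
  \<comment> \<open>For a general filter the base point of a derivative is
    \<open>Lim F (\<lambda>x. x)\<close>. Spelling the difference quotient out reduces the claim to
    a limit in each component.\<close>
  have "((\<lambda>y. ((f y - f (Lim F (\<lambda>x. x))) - (y - Lim F (\<lambda>x. x)) *\<^sub>R f') /\<^sub>R norm (y - Lim F (\<lambda>x. x))) \<longlongrightarrow> 0) F"
    using assms unfolding has_vector_derivative_def has_derivative_def
    by (intro vec_tendstoI) simp
  then show ?thesis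
    unfolding has_vector_derivative_def has_derivative_def
    by (simp add: bounded_linear_scaleR_left)
qed

lemma matrix_exp_0: "matrix_exp A 0 = mat 1"
  by (simp add: matrix_exp_def vec_eq_iff powser_zero matrix_power_0 del: times_divide_eq_left)

lemma has_vector_derivative_matrix_exp:
  "(matrix_exp A has_vector_derivative A ** matrix_exp A t) (at t)"
proof -
  let ?c = "\<lambda>i j m. matrix_power A m $ i $ j / fact m"
  have deriv: "((\<lambda>t. matrix_exp A t $ i $ j) has_vector_derivative (A ** matrix_exp A t) $ i $ j) (at t)"
    for i j
  proof -
    \<comment> \<open>\<open>diffs\<close> multiplies the coefficient of index \<open>Suc m\<close>
      by \<open>Suc m\<close>. This turns \<open>fact (Suc m)\<close> into \<open>fact m\<close> and
      leaves one extra factor \<open>A\<close> on the left.\<close>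
    have "diffs (?c i j) m = (\<Sum>k\<in>UNIV. A $ i $ k * ?c k j m)" for m
    proof -
      have "diffs (?c i j) m = (\<Sum>k\<in>UNIV. A $ i $ k * matrix_power A m $ k $ j) / fact m"
        by (simp add: diffs_def matrix_power_Suc matrix_matrix_mult_def del: of_nat_Suc)
      then show ?thesis
        by (simp add: sum_divide_distrib)
    qed
    then have "(\<Sum>m. diffs (?c i j) m * t ^ m) = (\<Sum>m. \<Sum>k\<in>UNIV. A $ i $ k * (?c k j m * t ^ m))"
      by (simp add: sum_distrib_right sum_distrib_left mult_ac)
    also have "\<dots> = (\<Sum>k\<in>UNIV. \<Sum>m. A $ i $ k * (?c k j m * t ^ m))"
      by (intro suminf_sum summable_mult summable_matrix_exp)
    also have "\<dots> = (\<Sum>k\<in>UNIV. A $ i $ k * (\<Sum>m. ?c k j m * t ^ m))"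
      by (intro sum.cong refl suminf_mult summable_matrix_exp)
    also have "\<dots> = (A ** matrix_exp A t) $ i $ j"
      by (simp add: matrix_matrix_mult_def matrix_exp_def)
    finally show ?thesis
      using termdiffs_strong_converges_everywhere[of "?c i j" t] summable_matrix_exp[of A i j]
      by (simp add: matrix_exp_def has_real_derivative_iff_has_vector_derivative)
  qed
  show ?thesis
    by (intro has_vector_derivative_vec_lambda deriv)
qed

text \<open>Commutation holds for every power and survives summation, since the finite sums of a
  matrix product may be exchanged with the convergent entry series. It is applied to the reflection
  \<open>R\<close>.\<close>

lemma matrix_exp_commute:
  assumes "A ** R = R ** A"
  shows "matrix_exp A t ** R = R ** matrix_exp A t"
proof -
  have "(matrix_exp A t ** R) $ i $ j = (R ** matrix_exp A t) $ i $ j" for i j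
  proof -
    let ?c = "\<lambda>i j m. matrix_power A m $ i $ j / fact m * t ^ m"
    have "(matrix_exp A t ** R) $ i $ j = (\<Sum>k\<in>UNIV. \<Sum>m. ?c i k m * R $ k $ j)"
      by (simp add: matrix_matrix_mult_def matrix_exp_def suminf_mult2 summable_matrix_exp
          del: times_divide_eq_left)
    also have "\<dots> = (\<Sum>m. \<Sum>k\<in>UNIV. ?c i k m * R $ k $ j)"
      by (intro suminf_sum[symmetric] summable_mult2 summable_matrix_exp)
    also have "\<dots> = (\<Sum>m. (matrix_power A m ** R) $ i $ j / fact m * t ^ m)"
      by (simp add: matrix_matrix_mult_def sum_distrib_right sum_distrib_left sum_divide_distrib mult_ac)
    also have "\<dots> = (\<Sum>m. (R ** matrix_power A m) $ i $ j / fact m * t ^ m)"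
      by (simp add: matrix_power_commute[OF assms])
    also have "\<dots> = (\<Sum>m. \<Sum>k\<in>UNIV. R $ i $ k * ?c k j m)"
      by (simp add: matrix_matrix_mult_def sum_distrib_right sum_distrib_left sum_divide_distrib mult_ac)
    also have "\<dots> = (\<Sum>k\<in>UNIV. \<Sum>m. R $ i $ k * ?c k j m)"
      by (intro suminf_sum summable_mult summable_matrix_exp)
    also have "\<dots> = (R ** matrix_exp A t) $ i $ j"
      by (simp add: matrix_matrix_mult_def matrix_exp_def suminf_mult summable_matrix_exp
          del: times_divide_eq_left)
    finally show ?thesis .
  qed
  then show ?thesis by (simp add: vec_eq_iff)
qed

section \<open>Lie algebras of matrix groups\<close>

lemma lie_algebraE:
  assumes "A \<in> lie_algebra G"
  obtains \<gamma> where "\<And>t. \<gamma> t \<in> G" "\<gamma> 0 = mat 1" "(\<gamma> has_vector_derivative A) (at 0)"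
  using assms unfolding lie_algebra_def by blast

text \<open>The derivative at all times is kept because new C1 curves are built from the old ones.
  Where only a derivative at \<open>0\<close> is compared, \<open>lie_algebraE\<close>
  serves.\<close>

lemma lie_algebra_C1E:
  assumes "A \<in> lie_algebra G"
  obtains \<gamma> \<gamma>' where "\<And>t. (\<gamma> has_vector_derivative \<gamma>' t) (at t)" "continuous_on UNIV \<gamma>'"
    "\<And>t. \<gamma> t \<in> G" "\<gamma> 0 = mat 1" "\<gamma>' 0 = A"
proof -
  obtain \<gamma> \<gamma>' where \<gamma>: "\<And>t. (\<gamma> has_vector_derivative \<gamma>' t) (at t)" "continuous_on UNIV \<gamma>'"
      "range \<gamma> \<subseteq> G" "\<gamma> 0 = mat 1" "(\<gamma> has_vector_derivative A) (at 0)"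
    using assms unfolding lie_algebra_def C1_differentiable_on_def by blast
  moreover have "\<gamma>' 0 = A"
    using \<gamma>(1,5) vector_derivative_unique_at by blast
  ultimately show ?thesis
    using that by blast
qed

lemma lie_algebra_C1I:
  assumes "\<And>t. (\<gamma> has_vector_derivative \<gamma>' t) (at t)" "continuous_on UNIV \<gamma>'"
    "\<And>t. \<gamma> t \<in> G" "\<gamma> 0 = mat 1" "\<gamma>' 0 = A"
  shows "A \<in> lie_algebra G"
  using assms unfolding lie_algebra_def C1_differentiable_on_def by blast

lemma continuous_on_has_vector_derivative:
  assumes "\<And>t. (\<gamma> has_vector_derivative \<gamma>' t) (at t)"
  shows "continuous_on S \<gamma>"
  using assms by (meson continuous_at_imp_continuous_on has_vector_derivative_continuous)

text \<open>
  The derivative of \<open>\<Phi> (exp (tA))\<close> at \<open>t = s\<close> is that of \<open>\<Phi> (\<gamma> h ** exp (sA))\<close> at \<open>h = 0\<close>, for a curve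
  \<open>\<gamma>\<close> in \<open>G\<close> with velocity \<open>A\<close>, and the latter function is constant. This replaces the closed
  subgroup theorem.
\<close>

lemma invariant_along_matrix_exp:
  fixes \<Phi> :: "real^'n^'n::finite \<Rightarrow> real"
  assumes A: "A \<in> lie_algebra G"
    and diff: "\<And>P. \<Phi> differentiable (at P)"
    and inv: "\<And>g P. g \<in> G \<Longrightarrow> \<Phi> (g ** P) = \<Phi> P"
  shows "\<Phi> (matrix_exp A t) = \<Phi> (mat 1)"
proof -
  obtain \<gamma> where \<gamma>: "\<And>t. \<gamma> t \<in> G" "\<gamma> 0 = mat 1" "(\<gamma> has_vector_derivative A) (at 0)"
    using A by (rule lie_algebraE) blast
  have "((\<lambda>s. \<Phi> (matrix_exp A s)) has_derivative (\<lambda>h. 0)) (at s within UNIV)" for s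
  proof -
    let ?E = "matrix_exp A s"
    obtain D where D: "(\<Phi> has_derivative D) (at ?E)"
      using diff unfolding differentiable_def by blast
    have "((\<lambda>h. \<gamma> h ** ?E) has_derivative (\<lambda>h. (h *\<^sub>R A) ** ?E)) (at 0)"
      using \<gamma>(3) unfolding has_vector_derivative_def
      by (rule bounded_linear.has_derivative[OF matrix_mult.bounded_linear_left])
    then have "((\<lambda>h. \<Phi> (\<gamma> h ** ?E)) has_derivative (\<lambda>h. D ((h *\<^sub>R A) ** ?E))) (at 0)"
      by (rule has_derivative_compose) (use D \<gamma>(2) in simp)
    then have "((\<lambda>h. \<Phi> ?E) has_derivative (\<lambda>h. D ((h *\<^sub>R A) ** ?E))) (at 0)"
      by (simp add: inv \<gamma>(1))
    then have zero: "(\<lambda>h. D ((h *\<^sub>R A) ** ?E)) = (\<lambda>h. 0)"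
      by (rule has_derivative_unique) (rule has_derivative_const)
    have "((\<lambda>s. \<Phi> (matrix_exp A s)) has_derivative (\<lambda>h. D (h *\<^sub>R (A ** ?E)))) (at s)"
      using has_vector_derivative_matrix_exp[of A s] D unfolding has_vector_derivative_def
      by (rule has_derivative_compose)
    then show ?thesis
      using zero by (simp add: matrix_mult.scaleR_left)
  qed
  then have "\<Phi> (matrix_exp A t) = \<Phi> (matrix_exp A 0)"
    using has_derivative_zero_unique[of UNIV "\<lambda>s. \<Phi> (matrix_exp A s)" t 0] by auto
  then show ?thesis by (simp add: matrix_exp_0)
qed

text \<open>The exponential itself is the witnessing curve. In the final proof this is how an
  element is placed in the Lie algebra of the plane stabiliser.\<close>

lemma matrix_exp_in_lie_algebra:
  assumes "\<And>t. matrix_exp A t \<in> G"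
  shows "A \<in> lie_algebra G"
proof (rule lie_algebra_C1I[where \<gamma> = "matrix_exp A" and \<gamma>' = "\<lambda>t. A ** matrix_exp A t"])
  show "(matrix_exp A has_vector_derivative A ** matrix_exp A t) (at t)" for t
    by (rule has_vector_derivative_matrix_exp)
  show "continuous_on UNIV (\<lambda>t. A ** matrix_exp A t)"
    by (intro matrix_mult.continuous_on continuous_on_const
        continuous_on_has_vector_derivative[OF has_vector_derivative_matrix_exp])
  show "A ** matrix_exp A 0 = A"
    by (simp add: matrix_exp_0)
qed (simp_all add: assms matrix_exp_0)

section \<open>Closure properties of the Lie algebra and linearised constraints\<close>

lemma lie_algebra_add:
  assumes A: "A \<in> lie_algebra G" and B: "B \<in> lie_algebra G"
    and mult: "\<And>P Q. P \<in> G \<Longrightarrow> Q \<in> G \<Longrightarrow> P ** Q \<in> G"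
  shows "A + B \<in> lie_algebra G"
proof -
  obtain \<gamma> \<gamma>' where \<gamma>: "\<And>t. (\<gamma> has_vector_derivative \<gamma>' t) (at t)" "continuous_on UNIV \<gamma>'"
      "\<And>t. \<gamma> t \<in> G" "\<gamma> 0 = mat 1" "\<gamma>' 0 = A"
    using A by (rule lie_algebra_C1E) blast
  obtain \<delta> \<delta>' where \<delta>: "\<And>t. (\<delta> has_vector_derivative \<delta>' t) (at t)" "continuous_on UNIV \<delta>'"
      "\<And>t. \<delta> t \<in> G" "\<delta> 0 = mat 1" "\<delta>' 0 = B"
    using B by (rule lie_algebra_C1E) blast
  note cont = continuous_on_has_vector_derivative[OF \<gamma>(1)] continuous_on_has_vector_derivative[OF \<delta>(1)]
  show ?thesis
  proof (rule lie_algebra_C1I)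
    show "((\<lambda>t. \<gamma> t ** \<delta> t) has_vector_derivative (\<gamma> t ** \<delta>' t + \<gamma>' t ** \<delta> t)) (at t)" for t
      by (intro matrix_mult.has_vector_derivative \<gamma> \<delta>)
    show "continuous_on UNIV (\<lambda>t. \<gamma> t ** \<delta>' t + \<gamma>' t ** \<delta> t)"
      by (intro continuous_on_add matrix_mult.continuous_on cont \<gamma> \<delta>)
  qed (simp_all add: \<gamma> \<delta> mult add.commute)
qed

text \<open>Only conjugation by \<open>R\<close> has to preserve \<open>G\<close>: the reflection to
  which this is applied may have determinant \<open>-1\<close> or reverse signs of forms, and so may
  lie outside \<open>G\<close>. The equation \<open>R ** S = mat 1\<close> makes the conjugated
  curve start at the identity.\<close>

lemma lie_algebra_conjugate:
  assumes A: "A \<in> lie_algebra G" and R: "R ** S = mat 1"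
    and conj: "\<And>P. P \<in> G \<Longrightarrow> R ** P ** S \<in> G"
  shows "R ** A ** S \<in> lie_algebra G"
proof -
  obtain \<gamma> \<gamma>' where \<gamma>: "\<And>t. (\<gamma> has_vector_derivative \<gamma>' t) (at t)" "continuous_on UNIV \<gamma>'"
      "\<And>t. \<gamma> t \<in> G" "\<gamma> 0 = mat 1" "\<gamma>' 0 = A"
    using A by (rule lie_algebra_C1E) blast
  have bl: "bounded_linear (\<lambda>P. R ** P ** S)"
    by (rule bounded_linear_compose[OF matrix_mult.bounded_linear_left matrix_mult.bounded_linear_right])
  show ?thesis
    by (rule lie_algebra_C1I[OF bounded_linear.has_vector_derivative[OF bl \<gamma>(1)]
          bounded_linear.continuous_on[OF bl \<gamma>(2)]]) (simp_all add: \<gamma> R conj)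
qed

text \<open>Differentiating a linear equation that holds on \<open>G\<close> gives its homogeneous
  version. It is used for the equation \<open>P ** R - R ** P = 0\<close>.\<close>

lemma lie_algebra_linear_constraint:
  fixes L :: "real^'n^'n::finite \<Rightarrow> 'b::real_normed_vector"
  assumes A: "A \<in> lie_algebra G" and L: "bounded_linear L"
    and const: "\<And>P. P \<in> G \<Longrightarrow> L P = c"
  shows "L A = 0"
proof -
  obtain \<gamma> where \<gamma>: "\<And>t. \<gamma> t \<in> G" "\<gamma> 0 = mat 1" "(\<gamma> has_vector_derivative A) (at 0)"
    using A by (rule lie_algebraE) blast
  have "((\<lambda>t. L (\<gamma> t)) has_vector_derivative L A) (at 0)"
    by (rule bounded_linear.has_vector_derivative[OF L \<gamma>(3)])
  then have "((\<lambda>t. c) has_vector_derivative L A) (at 0)"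
    by (simp add: const \<gamma>(1))
  then show ?thesis
    by (rule vector_derivative_unique_at) (rule has_vector_derivative_const)
qed

lemma bounded_linear_transpose: "bounded_linear (transpose :: real^'n^'m \<Rightarrow> real^'m^'n)"
  by (intro linear_conv_bounded_linear[THEN iffD1] linearI)
     (simp_all add: transpose_def vec_eq_iff)

text \<open>Differentiate \<open>transpose P ** P = mat 1\<close> along a curve at the
  identity.\<close>

lemma lie_algebra_skew:
  assumes A: "A \<in> lie_algebra G" and G: "\<And>P. P \<in> G \<Longrightarrow> orthogonal_matrix P"
  shows "transpose A = - A"
proof -
  obtain \<gamma> where \<gamma>: "\<And>t. \<gamma> t \<in> G" "\<gamma> 0 = mat 1" "(\<gamma> has_vector_derivative A) (at 0)"
    using A by (rule lie_algebraE) blast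
  have "((\<lambda>t. transpose (\<gamma> t) ** \<gamma> t) has_vector_derivative
      (transpose (\<gamma> 0) ** A + transpose A ** \<gamma> 0)) (at 0)"
    by (intro matrix_mult.has_vector_derivative \<gamma>
        bounded_linear.has_vector_derivative[OF bounded_linear_transpose])
  moreover have "transpose (\<gamma> t) ** \<gamma> t = mat 1" for t
    using G[OF \<gamma>(1)] orthogonal_matrix by blast
  ultimately have "((\<lambda>t::real. mat 1 :: real^'a^'a) has_vector_derivative (A + transpose A)) (at 0)"
    by (simp add: \<gamma>(2) transpose_mat)
  then have "A + transpose A = 0"
    by (rule vector_derivative_unique_at) (rule has_vector_derivative_const)
  then show ?thesis
    by (simp add: eq_neg_iff_add_eq_0 add.commute)
qed

section \<open>Pullbacks of forms and the reflection in a plane\<close>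

lemma inner_matrix_vector_mult: "((B :: real^'n^'m) *v x) \<bullet> y = x \<bullet> (transpose B *v y)"
  by (metis dot_lmul_matrix vector_transpose_matrix)

lemma matrix_vector_mult_uminus_left: "(- A) *v x = - ((A :: real^'n^'m) *v x)"
  by (simp add: vec_eq_iff matrix_vector_mult_def sum_negf)

lemma pullback_mult: "pullback (P ** Q) \<alpha> = pullback Q (pullback P \<alpha>)"
  by (simp add: pullback_def matrix_vector_mul_assoc comp_def)

lemma pullback_mat_1: "pullback (mat 1) \<alpha> = \<alpha>"
  by (simp add: pullback_def)

lemma pullback_cmult: "pullback P (\<lambda>vs. c * \<alpha> vs) = (\<lambda>vs. c * pullback P \<alpha> vs)"
  by (simp add: pullback_def)

lemma pullback_sum: "pullback P (\<lambda>vs. \<Sum>i\<in>I. \<alpha> i vs) = (\<lambda>vs. \<Sum>i\<in>I. pullback P (\<alpha> i) vs)"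
  by (simp add: pullback_def)

section \<open>Differentiable dependence of pullbacks on the matrix\<close>

lemma differentiable_matrix_vector_inner:
  "(\<lambda>P::real^'n^'m. w \<bullet> (P *v v)) differentiable (at P)"
proof -
  have "linear (\<lambda>P::real^'n^'m. w \<bullet> (P *v v))"
    by (intro linearI) (simp_all add: matrix_vector_mult_add_rdistrib inner_add_right
        flip: scaleR_matrix_vector_assoc)
  then show ?thesis
    by (intro linear_imp_differentiable)
qed

lemma differentiable_prod:
  fixes f :: "'i \<Rightarrow> 'a::real_normed_vector \<Rightarrow> real"
  assumes "\<And>i. i \<in> I \<Longrightarrow> f i differentiable (at x)"
  shows "(\<lambda>x. \<Prod>i\<in>I. f i x) differentiable (at x)"
proof -
  obtain f' where "\<And>i. i \<in> I \<Longrightarrow> (f i has_derivative f' i) (at x)"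
    using assms unfolding differentiable_def by metis
  then show ?thesis
    unfolding differentiable_def by (blast intro: has_derivative_prod)
qed

text \<open>The pullback is a polynomial in the entries of \<open>P\<close>: a signed sum of
  products of linear functions. Such differentiability is what
  \<open>invariant_along_matrix_exp\<close> asks for.\<close>

lemma differentiable_pullback_wedge:
  "(\<lambda>P. pullback P (wedge ws) vs) differentiable (at P)"
proof (cases "length vs = length ws")
  case True
  have "(\<lambda>P. \<Sum>p | p permutes {..<length ws}. of_int (sign p) *
      (\<Prod>i<length ws. ws ! i \<bullet> (P *v vs ! p i))) differentiable (at P)"
    by (intro differentiable_sum ballI differentiable_mult differentiable_const differentiable_prod
        differentiable_matrix_vector_inner finite_permutations) auto
  moreover have "pullback P (wedge ws) vs = (\<Sum>p | p permutes {..<length ws}. of_int (sign p) *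
      (\<Prod>i<length ws. ws ! i \<bullet> (P *v vs ! p i)))" for P
    unfolding pullback_def wedge_def using True
    by (auto intro!: sum.cong prod.cong simp: permutes_in_image[where S = "{..<length ws}", simplified])
  ultimately show ?thesis by simp
qed (simp add: pullback_def wedge_def)

lemma differentiable_pullback_bigraded:
  assumes "\<alpha> \<in> bigraded W p q"
  shows "(\<lambda>P. pullback P \<alpha> vs) differentiable (at P)"
proof -
  obtain N :: nat and c ws us where "\<alpha> = (\<lambda>vs. \<Sum>i<N. c i * wedge (ws i @ us i) vs)"
    using assms unfolding bigraded_def by blast
  then have "(\<lambda>P. pullback P \<alpha> vs) = (\<lambda>P. \<Sum>i<N. c i * pullback P (wedge (ws i @ us i)) vs)"
    by (simp add: pullback_sum pullback_cmult)
  then show ?thesis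
    by (auto intro!: differentiable_sum differentiable_mult differentiable_pullback_wedge)
qed

lemma differentiable_pullback_bigraded_sum:
  assumes "\<alpha> \<in> bigraded_sum W m Q"
  shows "(\<lambda>P. pullback P \<alpha> vs) differentiable (at P)"
proof -
  obtain \<beta> where "\<alpha> = (\<lambda>vs. \<Sum>q | q \<le> m \<and> Q q. \<beta> q vs)"
    and "\<And>q. q \<le> m \<Longrightarrow> Q q \<Longrightarrow> \<beta> q \<in> bigraded W (m - q) q"
    using assms unfolding bigraded_sum_def by blast
  then show ?thesis
    by (auto simp: pullback_sum intro!: differentiable_sum differentiable_pullback_bigraded)
qed

lemma differentiable_entry: "(\<lambda>P::real^'n^'m. P $ i $ j) differentiable (at P)"
  by (intro bounded_linear_imp_differentiable bounded_linear_compose[OF bounded_linear_vec_nth]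
      bounded_linear_vec_nth)

lemma differentiable_det: "(det :: real^'n^'n \<Rightarrow> real) differentiable (at P)"
  unfolding det_def[abs_def]
  by (intro differentiable_sum ballI differentiable_mult differentiable_const differentiable_prod
      finite_permutations differentiable_entry finite)

section \<open>The reflection in a plane and its action on forms\<close>

definition plane_reflection :: "(real^'n) set \<Rightarrow> real^'n^'n::finite \<Rightarrow> bool" where
  "plane_reflection W R \<longleftrightarrow> transpose R = R \<and> R ** R = mat 1 \<and>
     W = {w. R *v w = w} \<and> (\<forall>u\<in>W\<^sup>\<bottom>. R *v u = - u)"

text \<open>Take \<open>R = 2 P - 1\<close> with \<open>P\<close> the orthogonal projection onto
  \<open>W\<close> in an orthonormal basis \<open>es\<close>. The basis and the formula are exported
  because \<open>bigraded_if_anticommute\<close> builds its wedges from them.\<close>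

lemma oriented_plane_reflection:
  fixes W :: "(real^'n::finite) set"
  assumes "oriented_plane k W vol"
  obtains R es where "plane_reflection W R" "length es = k" "set es \<subseteq> W"
    "\<And>x. R *v x = 2 *\<^sub>R (\<Sum>i<k. (es ! i \<bullet> x) *\<^sub>R es ! i) - x"
proof -
  obtain es where es: "length es = k" "span (set es) = W"
      and on: "\<And>i j. i < k \<Longrightarrow> j < k \<Longrightarrow> es ! i \<bullet> es ! j = (if i = j then 1 else 0)"
    using assms unfolding oriented_plane_def by blast
  define P where "P = (\<lambda>x. \<Sum>i<k. (es ! i \<bullet> x) *\<^sub>R es ! i)"
  have P: "linear P"
    by (intro linearI) (simp_all add: P_def inner_add_right scaleR_add_left sum.distrib scaleR_sum_right)
  have es_W: "es ! i \<in> W" if "i < k" for i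
    using that es by (metis nth_mem span_base)
  have PW: "P x \<in> W" for x
    unfolding P_def using es_W es(2)[symmetric] by (auto intro!: span_sum span_scale)
  have "P (es ! j) = es ! j" if "j < k" for j
  proof -
    have "P (es ! j) = (\<Sum>i<k. if i = j then es ! i else 0)"
      unfolding P_def by (intro sum.cong) (use that on in auto)
    with that show ?thesis by simp
  qed
  then have "\<And>x. x \<in> set es \<Longrightarrow> P x = id x"
    using es(1) by (auto simp: in_set_conv_nth)
  then have Pid: "P w = w" if "w \<in> W" for w
    using linear_eq_on_span[OF P linear_id, of "set es" w] es(2) that by auto
  have P0: "P u = 0" if "u \<in> W\<^sup>\<bottom>" for u
    using that es_W by (auto simp: P_def orthogonal_comp_def orthogonal_def intro!: sum.neutral)
  have Psym: "P x \<bullet> y = x \<bullet> P y" for x y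
    by (simp add: P_def inner_sum_left inner_sum_right inner_commute mult.commute)
  define R where "R = matrix (\<lambda>x. 2 *\<^sub>R P x - x)"
  have "linear (\<lambda>x. 2 *\<^sub>R P x - x)"
    by (intro linear_compose_sub linear_compose_scale_right P linear_ident)
  then have R: "R *v x = 2 *\<^sub>R P x - x" for x
    unfolding R_def by (simp add: matrix_works)
  have "transpose R = R"
  proof -
    have "(R *v x) \<bullet> y = x \<bullet> (R *v y)" for x y
      by (simp add: R inner_diff_left inner_diff_right Psym)
    then have "adjoint ((*v) R) = (*v) R"
      by (intro adjoint_unique) simp
    then show ?thesis
      by (simp add: adjoint_matrix matrix_eq fun_eq_iff)
  qed
  moreover have "R *v (R *v x) = x" for x
    by (simp add: R linear_diff[OF P] linear_scale[OF P] Pid PW algebra_simps flip: scaleR_2)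
  then have "R ** R = mat 1"
    by (simp add: matrix_eq flip: matrix_vector_mul_assoc)
  moreover have "W = {w. R *v w = w}"
  proof (intro equalityI subsetI)
    fix w assume "w \<in> {w. R *v w = w}"
    then have "2 *\<^sub>R P w = 2 *\<^sub>R w" by (simp add: R scaleR_2 algebra_simps)
    then show "w \<in> W" using PW[of w] by simp
  qed (simp add: R Pid scaleR_2)
  ultimately have "plane_reflection W R"
    unfolding plane_reflection_def by (simp add: R P0)
  then show ?thesis
    using that[of R es] es span_superset[of "set es"] by (simp add: R P_def)
qed

text \<open>By symmetry \<open>R\<close> moves from the arguments to the factors of the wedge. There
  it fixes each member of \<open>ws\<close> and negates each member of \<open>us\<close>, so every
  permutation term acquires the same sign.\<close>

lemma pullback_reflection_wedge:
  assumes R: "plane_reflection W R" and ws: "set ws \<subseteq> W" and us: "set us \<subseteq> W\<^sup>\<bottom>"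
  shows "pullback R (wedge (ws @ us)) = (\<lambda>vs. (-1) ^ length us * wedge (ws @ us) vs)"
proof
  fix vs
  let ?xs = "ws @ us" and ?n = "length (ws @ us)"
  have Rx: "?xs ! i \<bullet> (R *v v) = (if i < length ws then 1 else -1) * (?xs ! i \<bullet> v)" if "i < ?n" for i v
  proof -
    have "?xs ! i \<bullet> (R *v v) = (R *v (?xs ! i)) \<bullet> v"
      using R unfolding plane_reflection_def by (metis inner_matrix_vector_mult)
    also have "R *v (?xs ! i) = (if i < length ws then 1 else -1) *\<^sub>R (?xs ! i)"
    proof (cases "i < length ws")
      case True
      then have "?xs ! i \<in> W" using ws by (auto simp: nth_append)
      then show ?thesis using R True unfolding plane_reflection_def by auto
    next
      case False
      then have "?xs ! i \<in> W\<^sup>\<bottom>" using us that by (auto simp: nth_append)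
      then show ?thesis using R False unfolding plane_reflection_def by auto
    qed
    finally show ?thesis by simp
  qed
  have signs: "(\<Prod>i<?n. if i < length ws then 1 else -1 :: real) = (-1) ^ length us"
  proof -
    have "(\<Prod>i<?n. if i < length ws then 1 else -1 :: real)
        = (\<Prod>i\<in>{length ws..<?n}. -1)"
      by (intro prod.mono_neutral_cong_right) auto
    then show ?thesis by simp
  qed
  have "(\<Prod>i<?n. ?xs ! i \<bullet> map ((*v) R) vs ! p i) = (-1) ^ length us * (\<Prod>i<?n. ?xs ! i \<bullet> vs ! p i)"
    if "p permutes {..<?n}" "length vs = ?n" for p
  proof -
    have "(\<Prod>i<?n. ?xs ! i \<bullet> map ((*v) R) vs ! p i)
        = (\<Prod>i<?n. (if i < length ws then 1 else -1) * (?xs ! i \<bullet> vs ! p i))"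
    proof (intro prod.cong refl)
      fix i assume i: "i \<in> {..<?n}"
      then have "p i < ?n" using permutes_in_image[OF that(1), of i] by simp
      then show "?xs ! i \<bullet> map ((*v) R) vs ! p i = (if i < length ws then 1 else -1) * (?xs ! i \<bullet> vs ! p i)"
        using Rx[of i] i that(2) by (simp del: length_append)
    qed
    then show ?thesis by (simp only: prod.distrib signs)
  qed
  then show "pullback R (wedge ?xs) vs = (-1) ^ length us * wedge ?xs vs"
    unfolding pullback_def wedge_def
    by (auto simp: sum_distrib_left mult_ac simp del: length_append intro!: sum.cong)
qed

lemma pullback_reflection_bigraded:
  assumes R: "plane_reflection W R" and \<alpha>: "\<alpha> \<in> bigraded W p q"
  shows "pullback R \<alpha> = (\<lambda>vs. (-1) ^ q * \<alpha> vs)"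
proof -
  obtain N :: nat and c ws us where \<alpha>: "\<alpha> = (\<lambda>vs. \<Sum>i<N. c i * wedge (ws i @ us i) vs)"
    and wu: "\<forall>i<N. length (ws i) = p \<and> set (ws i) \<subseteq> W \<and> length (us i) = q \<and> set (us i) \<subseteq> W\<^sup>\<bottom>"
    using \<alpha> unfolding bigraded_def by blast
  have "pullback R (wedge (ws i @ us i)) = (\<lambda>vs. (-1) ^ q * wedge (ws i @ us i) vs)"
    if "i < N" for i
    using pullback_reflection_wedge[OF R, of "ws i" "us i"] wu that by simp
  then show ?thesis
    unfolding \<alpha> pullback_sum pullback_cmult
    by (simp add: sum_distrib_left mult_ac cong: sum.cong_simp)
qed

text \<open>The scalar \<open>s\<close> treats both parities at once: it is \<open>1\<close> for
  \<open>even\<close> and \<open>-1\<close> for \<open>odd\<close>.\<close>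

lemma pullback_reflection_bigraded_sum:
  assumes R: "plane_reflection W R" and \<alpha>: "\<alpha> \<in> bigraded_sum W m Q"
    and s: "\<And>q. Q q \<Longrightarrow> (-1) ^ q = s"
  shows "pullback R \<alpha> = (\<lambda>vs. s * \<alpha> vs)"
proof -
  obtain \<beta> where \<alpha>: "\<alpha> = (\<lambda>vs. \<Sum>q | q \<le> m \<and> Q q. \<beta> q vs)"
    and \<beta>: "\<And>q. q \<le> m \<Longrightarrow> Q q \<Longrightarrow> \<beta> q \<in> bigraded W (m - q) q"
    using \<alpha> unfolding bigraded_sum_def by blast
  have "pullback R (\<beta> q) = (\<lambda>vs. s * \<beta> q vs)" if "q \<le> m" "Q q" for q
    using pullback_reflection_bigraded[OF R \<beta>[OF that]] s[OF that(2)] by simp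
  then show ?thesis
    unfolding \<alpha> pullback_sum by (simp add: sum_distrib_left cong: sum.cong_simp)
qed

section \<open>The stabiliser group of the forms\<close>

lemma rotation_matrix_mult:
  "rotation_matrix P \<Longrightarrow> rotation_matrix Q \<Longrightarrow> rotation_matrix (P ** Q :: real^'n^'n)"
  by (simp add: rotation_matrix_def orthogonal_matrix_mul det_mul)

lemma form_stabilizer_mult:
  assumes "P \<in> form_stabilizer N \<alpha>" "Q \<in> form_stabilizer N \<alpha>"
  shows "P ** Q \<in> form_stabilizer N \<alpha>"
  using assms unfolding form_stabilizer_def
  by (auto simp: rotation_matrix_mult pullback_mult)

lemma form_stabilizer_orthogonal: "P \<in> form_stabilizer N \<alpha> \<Longrightarrow> orthogonal_matrix P"
  by (simp add: form_stabilizer_def rotation_matrix_def)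

text \<open>As \<open>P\<close> fixes \<open>\<alpha> j\<close>, the scalar \<open>s\<close> passes
  through its pullback, and what remains is the pullback by \<open>R\<close> applied twice, which is
  the identity. In the determinant \<open>det R\<close> occurs twice and cancels.\<close>

lemma form_stabilizer_reflection_conjugate:
  assumes P: "P \<in> form_stabilizer N \<alpha>" and R: "transpose R = R" "R ** R = mat 1"
    and semi: "\<And>j. j \<le> N \<Longrightarrow> \<exists>s. pullback R (\<alpha> j) = (\<lambda>vs. s * \<alpha> j vs)"
  shows "R ** P ** R \<in> form_stabilizer N \<alpha>"
proof -
  have "orthogonal_matrix R"
    using R by (simp add: orthogonal_matrix)
  moreover have "det R * det R = 1"
    using R(2) by (metis det_I det_mul)
  ultimately have "rotation_matrix (R ** P ** R)"
    using P by (auto simp: form_stabilizer_def rotation_matrix_def orthogonal_matrix_mul det_mul)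
  moreover have "pullback (R ** P ** R) (\<alpha> j) = \<alpha> j" if j: "j \<le> N" for j
  proof -
    obtain s where s: "pullback R (\<alpha> j) = (\<lambda>vs. s * \<alpha> j vs)"
      using semi[OF j] by blast
    have "pullback P (\<alpha> j) = \<alpha> j"
      using P j by (simp add: form_stabilizer_def)
    then have "pullback (R ** P ** R) (\<alpha> j) = pullback R (pullback R (\<alpha> j))"
      by (simp add: pullback_mult s pullback_cmult)
    then show ?thesis
      using R(2) by (simp add: pullback_mat_1 flip: pullback_mult)
  qed
  ultimately show ?thesis
    by (simp add: form_stabilizer_def)
qed

text \<open>Each condition defining the group fixes the value of a real function of \<open>P\<close>
  that is unchanged under left multiplication by the group: entries of
  \<open>transpose P ** P\<close>, the determinant, values of
  \<open>pullback P (\<alpha> j)\<close>. Such functions keep along the exponential their value at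
  the identity.\<close>

lemma matrix_exp_in_form_stabilizer:
  assumes A: "A \<in> lie_algebra (form_stabilizer N \<alpha>)"
    and diff: "\<And>j vs P. j \<le> N \<Longrightarrow> (\<lambda>P. pullback P (\<alpha> j) vs) differentiable (at P)"
  shows "matrix_exp A t \<in> form_stabilizer N \<alpha>"
proof -
  let ?G = "form_stabilizer N \<alpha>" and ?E = "matrix_exp A t"
  note invariant = invariant_along_matrix_exp[OF A]
  have "transpose ?E ** ?E = mat 1"
  proof -
    \<comment> \<open>The right side is left unsimplified so that both sides are values of one
      function, at \<open>?E\<close> and at \<open>mat 1\<close>.\<close>
    have "(transpose ?E ** ?E) $ i $ j = (transpose (mat 1) ** mat 1) $ i $ j" for i j
    proof (rule invariant)
      show "(\<lambda>P. (transpose P ** P) $ i $ j) differentiable (at P)" for P :: "real^'a^'a"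
        unfolding matrix_matrix_mult_def transpose_def
        by (simp add: differentiable_entry)
      show "(transpose (g ** P) ** (g ** P)) $ i $ j = (transpose P ** P) $ i $ j" if "g \<in> ?G" for g P
        using form_stabilizer_orthogonal[OF that] unfolding orthogonal_matrix
        by (metis matrix_mul_assoc matrix_mul_lid matrix_transpose_mul)
    qed
    then show ?thesis by (simp add: vec_eq_iff transpose_mat)
  qed
  moreover have "det ?E = det (mat 1 :: real^'a^'a)"
    by (rule invariant[OF differentiable_det])
       (simp add: det_mul form_stabilizer_def rotation_matrix_def)
  moreover have "pullback ?E (\<alpha> j) vs = pullback (mat 1) (\<alpha> j) vs" if "j \<le> N" for j vs
    by (rule invariant) (simp_all add: diff that pullback_mult form_stabilizer_def)
  ultimately show ?thesis
    unfolding form_stabilizer_def by (simp add: rotation_matrix_def orthogonal_matrix pullback_mat_1 fun_eq_iff)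
qed

section \<open>Plane stabilisers as commutants of the reflection\<close>

lemma plane_stabilizer_iff_commute:
  assumes R: "plane_reflection W R" and G: "\<And>P. P \<in> G \<Longrightarrow> orthogonal_matrix P"
  shows "plane_stabilizer G W = {P \<in> G. P ** R = R ** P}"
proof (intro equalityI subsetI)
  fix P assume "P \<in> {P \<in> G. P ** R = R ** P}"
  then have P: "P \<in> G" "P ** R = R ** P" by auto
  have o: "transpose P ** P = mat 1" "P ** transpose P = mat 1"
    using G[OF P(1)] by (auto simp: orthogonal_matrix_def)
  have sym: "transpose R = R" and W: "W = {w. R *v w = w}"
    using R by (auto simp: plane_reflection_def)
  \<comment> \<open>\<open>P\<close> must map \<open>W\<close> onto \<open>W\<close>. The preimage
    of \<open>w\<close> is \<open>transpose P *v w\<close>, so the transpose has to preserve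
    \<open>W\<close>, the fixed space of \<open>R\<close>, as well.\<close>
  have P': "transpose P ** R = R ** transpose P"
    using arg_cong[OF P(2), of transpose] by (simp add: matrix_transpose_mul sym)
  have inv: "Q *v w \<in> W" if "Q ** R = R ** Q" "w \<in> W" for Q w
  proof -
    have "R *v w = w"
      using that(2) W by blast
    then have "R *v (Q *v w) = Q *v w"
      using that(1) by (metis matrix_vector_mul_assoc)
    then show ?thesis
      using W by blast
  qed
  have "w \<in> (*v) P ` W" if "w \<in> W" for w
  proof (rule image_eqI)
    show "w = P *v (transpose P *v w)"
      by (simp only: matrix_vector_mul_assoc o matrix_vector_mul_lid)
    show "transpose P *v w \<in> W"
      by (rule inv[OF P' that])
  qed
  then show "P \<in> plane_stabilizer G W"
    using P inv unfolding plane_stabilizer_def by auto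
next
  fix P assume P: "P \<in> plane_stabilizer G W"
  then have PG: "P \<in> G" and PW: "(*v) P ` W = W"
    by (auto simp: plane_stabilizer_def)
  have o: "transpose P ** P = mat 1"
    using G[OF PG] by (auto simp: orthogonal_matrix_def)
  have W: "W = {w. R *v w = w}" and Wo: "\<And>u. u \<in> W\<^sup>\<bottom> \<Longrightarrow> R *v u = - u"
    using R by (auto simp: plane_reflection_def)
  have inner: "(P *v x) \<bullet> (P *v y) = x \<bullet> y" for x y
    by (simp only: inner_matrix_vector_mult matrix_vector_mul_assoc o matrix_vector_mul_lid)
  have sub: "subspace W"
    unfolding W by (auto simp: subspace_def matrix_vector_right_distrib matrix_vector_mult_scaleR)
  \<comment> \<open>An orthogonal \<open>P\<close> with image \<open>W\<close> of \<open>W\<close>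
    also preserves \<open>W\<^sup>\<bottom>\<close>, so commutation is checked on the two summands,
    where \<open>R\<close> is a scalar.\<close>
  have "(P ** R) *v x = (R ** P) *v x" for x
  proof -
    obtain w u where x: "x = w + u" "w \<in> W" "u \<in> W\<^sup>\<bottom>"
      using subspace_sum_orthogonal_comp[OF sub] by (metis UNIV_I set_plus_elim)
    have "P *v w \<in> W" using x(2) PW by blast
    moreover have "P *v u \<in> W\<^sup>\<bottom>"
    proof -
      have "orthogonal y (P *v u)" if y: "y \<in> W" for y
      proof -
        have "y \<in> (*v) P ` W"
          using y by (simp only: PW)
        then obtain z where "y = P *v z" "z \<in> W" by (rule imageE)
        then show ?thesis
          using x(3) by (simp add: orthogonal_comp_def orthogonal_def inner)
      qed
      then show ?thesis
        by (simp add: orthogonal_comp_def)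
    qed
    moreover have "R *v z = z" if "z \<in> W" for z
      using that W by blast
    ultimately show ?thesis
      using x(2) Wo[OF x(3)] Wo unfolding x(1)
      by (simp add: matrix_vector_right_distrib vec.neg flip: matrix_vector_mul_assoc)
  qed
  then show "P \<in> {P \<in> G. P ** R = R ** P}"
    using PG by (simp add: matrix_eq)
qed

lemma lie_algebra_plane_stabilizer_commute:
  assumes R: "plane_reflection W R" and G: "\<And>P. P \<in> G \<Longrightarrow> orthogonal_matrix P"
    and B: "B \<in> lie_algebra (plane_stabilizer G W)"
  shows "B ** R = R ** B"
proof -
  have "bounded_linear (\<lambda>P. P ** R - R ** P)"
    by (intro bounded_linear_sub matrix_mult.bounded_linear_left matrix_mult.bounded_linear_right)
  then have "B ** R - R ** B = 0"
    by (rule lie_algebra_linear_constraint[OF B, where c = 0])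
       (simp add: plane_stabilizer_iff_commute[OF R G])
  then show ?thesis by simp
qed

section \<open>Adjoints for the entrywise inner product of matrices\<close>

lemma inner_matrix_mult_left: "(R ** A) \<bullet> B = A \<bullet> (transpose R ** (B :: real^'n^'m))"
proof -
  have "(R ** A) \<bullet> B = (\<Sum>i\<in>UNIV. \<Sum>j\<in>UNIV. \<Sum>k\<in>UNIV. R $ i $ k * A $ k $ j * B $ i $ j)"
    by (simp add: inner_vec_def matrix_matrix_mult_def sum_distrib_right)
  also have "\<dots> = (\<Sum>i\<in>UNIV. \<Sum>k\<in>UNIV. \<Sum>j\<in>UNIV. R $ i $ k * A $ k $ j * B $ i $ j)"
    by (intro sum.cong refl sum.swap)
  also have "\<dots> = (\<Sum>k\<in>UNIV. \<Sum>i\<in>UNIV. \<Sum>j\<in>UNIV. R $ i $ k * A $ k $ j * B $ i $ j)"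
    by (rule sum.swap)
  also have "\<dots> = (\<Sum>k\<in>UNIV. \<Sum>j\<in>UNIV. \<Sum>i\<in>UNIV. R $ i $ k * A $ k $ j * B $ i $ j)"
    by (intro sum.cong refl sum.swap)
  also have "\<dots> = A \<bullet> (transpose R ** B)"
    by (simp add: inner_vec_def matrix_matrix_mult_def transpose_def sum_distrib_left mult_ac)
  finally show ?thesis .
qed

lemma inner_transpose: "transpose A \<bullet> transpose B = A \<bullet> (B :: real^'n^'m)"
  unfolding inner_vec_def transpose_def by simp (rule sum.swap)

text \<open>Transposition preserves the inner product and exchanges the two sides of a product. With
  \<open>inner_matrix_mult_left\<close> this makes conjugation by a symmetric matrix
  self-adjoint.\<close>

lemma inner_matrix_mult_right: "(A ** R) \<bullet> B = A \<bullet> ((B :: real^'n^'m) ** transpose R)"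
proof -
  have "(A ** R) \<bullet> B = (transpose R ** transpose A) \<bullet> transpose B"
    by (simp only: matrix_transpose_mul[symmetric] inner_transpose)
  also have "\<dots> = transpose A \<bullet> (R ** transpose B)"
    by (simp only: inner_matrix_mult_left transpose_transpose)
  also have "R ** transpose B = transpose (B ** transpose R)"
    by (simp only: matrix_transpose_mul transpose_transpose)
  finally show ?thesis
    by (simp only: inner_transpose)
qed

section \<open>Skew matrices as two-forms of bidegree (1,1)\<close>

lemma wedge_pair: "wedge [e, u] [x, y] = (e \<bullet> x) * (u \<bullet> y) - (e \<bullet> y) * (u \<bullet> x)"
proof -
  have set2: "{..<2::nat} = {0, 1}" by auto
  have "{p. p permutes {0, 1::nat}} = {id, Transposition.transpose 0 1}"
    by (auto simp: permutes_doubleton_iff)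
  moreover have "id \<noteq> Transposition.transpose 0 (1::nat)"
    by (metis id_apply transpose_apply_first zero_neq_one)
  ultimately show ?thesis
    unfolding wedge_def
    by (simp add: set2 flip: numeral_2_eq_2)
       (simp add: sign_swap_id)
qed

text \<open>For symmetric \<open>R\<close> pullback of two-forms is conjugation of matrices. The
  sign of the reflection on \<open>bigraded W 1 1\<close> thereby becomes a matrix equation.\<close>

lemma pullback_two_form: "pullback R (two_form A) = two_form (transpose R ** A ** R)"
proof -
  have "(A *v (R *v x)) \<bullet> (R *v y) = ((transpose R ** A ** R) *v x) \<bullet> y" for x y
    using inner_matrix_vector_mult[of "transpose R" "A *v (R *v x)" y]
    by (simp only: matrix_vector_mul_assoc matrix_mul_assoc transpose_transpose)
  then show ?thesis
    by (auto simp: pullback_def two_form_def)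
qed

lemma two_form_uminus: "(\<lambda>vs. - two_form A vs) = two_form (- A)"
  by (auto simp: two_form_def matrix_vector_mult_uminus_left)

lemma two_form_inject: "two_form A = two_form B \<longleftrightarrow> A = B"
proof
  assume eq: "two_form A = two_form B"
  have "(A *v x) \<bullet> y = (B *v x) \<bullet> y" for x y
    using fun_cong[OF eq, of "[x, y]"] by (simp add: two_form_def)
  then have "A *v x = B *v x" for x
    using vector_eq_rdot by blast
  then show "A = B"
    by (simp add: matrix_eq)
qed simp

lemma anticommute_if_bigraded:
  assumes R: "plane_reflection W R" and A: "two_form A \<in> bigraded W 1 1"
  shows "R ** A ** R = - A"
  using pullback_reflection_bigraded[OF R A] R
  by (simp add: pullback_two_form two_form_uminus two_form_inject plane_reflection_def)

lemma bigraded_if_anticommute: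
  assumes R: "plane_reflection W R" and es: "length es = k" "set es \<subseteq> W"
    and Rx: "\<And>x. R *v x = 2 *\<^sub>R (\<Sum>i<k. (es ! i \<bullet> x) *\<^sub>R es ! i) - x"
    and A: "transpose A = - A" and anti: "R ** A ** R = - A"
  shows "two_form A \<in> bigraded W 1 1"
proof -
  have RR: "R ** R = mat 1" and sym: "transpose R = R" and WR: "\<And>w. w \<in> W \<Longrightarrow> R *v w = w"
    using R by (auto simp: plane_reflection_def)
  define P where "P x = (\<Sum>i<k. (es ! i \<bullet> x) *\<^sub>R es ! i)" for x
  have "A ** R = R ** (R ** A ** R)"
    by (simp add: matrix_mul_assoc RR)
  then have "A ** R = - (R ** A)"
    by (simp add: anti matrix_mult.minus_right)
  then have AR: "A *v (R *v x) = - (R *v (A *v x))" for x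
    by (metis matrix_vector_mul_assoc matrix_vector_mult_uminus_left)
  \<comment> \<open>Substituting \<open>R = 2 P - 1\<close> into \<open>A R = - R A\<close> gives
    \<open>2 A P - A = A - 2 P A\<close>.\<close>
  have split: "A *v x = A *v P x + P (A *v x)" for x
  proof -
    have "A *v (R *v x) = 2 *\<^sub>R (A *v P x) - A *v x"
      by (simp add: Rx P_def matrix_vector_mult_diff_distrib matrix_vector_mult_scaleR)
    moreover have "- (R *v (A *v x)) = A *v x - 2 *\<^sub>R P (A *v x)"
      by (simp add: Rx P_def)
    ultimately have "2 *\<^sub>R (A *v x) = 2 *\<^sub>R (A *v P x + P (A *v x))"
      using AR[of x] by (simp add: scaleR_2 algebra_simps)
    then show ?thesis by simp
  qed
  \<comment> \<open>For \<open>z\<close> and \<open>w\<close> in \<open>W\<close>, inserting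
    \<open>R\<close> before both and anticommuting shows that \<open>z \<bullet> (A *v w)\<close>
    equals its own negative.\<close>
  have perp: "A *v w \<in> W\<^sup>\<bottom>" if w: "w \<in> W" for w
  proof -
    have "z \<bullet> (A *v w) = 0" if z: "z \<in> W" for z
    proof -
      have "z \<bullet> (A *v w) = (R *v z) \<bullet> (A *v (R *v w))"
        using w z by (simp add: WR)
      also have "\<dots> = - (z \<bullet> (R *v (R *v (A *v w))))"
        by (simp only: AR inner_minus_right inner_matrix_vector_mult sym)
      also have "R *v (R *v (A *v w)) = A *v w"
        by (simp add: matrix_vector_mul_assoc matrix_mul_assoc RR)
      finally show ?thesis by simp
    qed
    then show ?thesis
      by (simp add: orthogonal_comp_def orthogonal_def)
  qed
  have skew: "(A *v x) \<bullet> y = - (x \<bullet> (A *v y))" for x y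
    by (simp add: inner_matrix_vector_mult A matrix_vector_mult_uminus_left)
  have AP: "(\<Sum>i<k. (es ! i \<bullet> x) * ((A *v (es ! i)) \<bullet> y)) = (A *v P x) \<bullet> y" for x y
    by (simp add: P_def vec.sum matrix_vector_mult_scaleR inner_sum_left)
  have Psym: "P x \<bullet> y = x \<bullet> P y" for x y
    by (simp add: P_def inner_sum_left inner_sum_right inner_commute mult.commute)
  txt \<open>\<open>A = \<Sum>\<^sub>i e\<^sub>i \<and> A e\<^sub>i\<close>, because \<open>A = AP + PA\<close> for the projection \<open>P = (1 + R) / 2\<close> onto \<open>W\<close>.\<close>
  have "two_form A vs = (\<Sum>i<k. 1 * wedge ([es ! i] @ [A *v (es ! i)]) vs)" for vs
  proof (cases "length vs = 2")
    case True
    then obtain x y where vs: "vs = [x, y]"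
      by (auto simp: numeral_2_eq_2 length_Suc_conv)
    have "(\<Sum>i<k. wedge [es ! i, A *v (es ! i)] [x, y]) = (A *v P x) \<bullet> y - (A *v P y) \<bullet> x"
      by (simp add: wedge_pair sum_subtractf AP)
    \<comment> \<open>Skewness of \<open>A\<close> and symmetry of \<open>P\<close> turn the second
      half of the antisymmetrised sum into the \<open>P A\<close> term.\<close>
    also have "(A *v P y) \<bullet> x = - (P (A *v x) \<bullet> y)"
      using skew[of "P y" x] Psym[of "A *v x" y] by (simp add: inner_commute)
    also have "(A *v P x) \<bullet> y - - (P (A *v x) \<bullet> y) = (A *v x) \<bullet> y"
      by (simp flip: inner_add_left split)
    finally show ?thesis
      by (simp add: vs two_form_def)
  qed (simp add: two_form_def wedge_def)
  then have "two_form A = (\<lambda>vs. \<Sum>i<k. 1 * wedge ([es ! i] @ [A *v (es ! i)]) vs)"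
    by blast
  moreover have "\<forall>i<k. length [es ! i] = 1 \<and> set [es ! i] \<subseteq> W \<and>
      length [A *v (es ! i)] = 1 \<and> set [A *v (es ! i)] \<subseteq> W\<^sup>\<bottom>"
    using es perp by (auto intro!: perp dest: nth_mem)
  ultimately show ?thesis
    unfolding bigraded_def mem_Collect_eq
    by (intro exI[of _ k] exI[of _ "\<lambda>_. 1"] exI[of _ "\<lambda>i. [es ! i]"]
        exI[of _ "\<lambda>i. [A *v (es ! i)]"] conjI)
qed

section \<open>Compliance\<close>

theorem proposition2p10:
  fixes N :: nat and d :: "nat \<Rightarrow> nat" and \<alpha> :: "nat \<Rightarrow> 'n::finite form"
  assumes "\<And>j. j \<le> N \<Longrightarrow> alternating_form (d j) (\<alpha> j)"
    and "calibration (d 0) (\<alpha> 0)"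
    and "transitive_on_calibrated (d 0) (\<alpha> 0) (form_stabilizer N \<alpha>)"
    and "\<And>W vol j. calibrated (d 0) (\<alpha> 0) W vol \<Longrightarrow> j \<le> N \<Longrightarrow>
           \<alpha> j \<in> bigraded_sum W (d j) even \<or> \<alpha> j \<in> bigraded_sum W (d j) odd"
  shows "compliant (d 0) (\<alpha> 0) (form_stabilizer N \<alpha>)"
  unfolding compliant_def
proof (intro allI impI)
  fix W vol assume cal: "calibrated (d 0) (\<alpha> 0) W vol"
  note parity = assms(4)[OF cal]
  let ?G = "form_stabilizer N \<alpha>"
  let ?\<gg> = "lie_algebra ?G" and ?\<hh> = "lie_algebra (plane_stabilizer ?G W)"
  have orth: "P \<in> ?G \<Longrightarrow> orthogonal_matrix P" for P
    by (rule form_stabilizer_orthogonal)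
  obtain R es where R: "plane_reflection W R" and es: "length es = d 0" "set es \<subseteq> W"
    and Rx: "\<And>x. R *v x = 2 *\<^sub>R (\<Sum>i<d 0. (es ! i \<bullet> x) *\<^sub>R es ! i) - x"
    by (rule oriented_plane_reflection[of "d 0" W vol]) (use cal calibrated_def in blast)+
  have sym: "transpose R = R" and RR: "R ** R = mat 1"
    using R by (auto simp: plane_reflection_def)
  \<comment> \<open>The parity hypothesis also yields differentiability, since it writes
    \<open>\<alpha> j\<close> as a finite combination of wedges.\<close>
  have diff: "(\<lambda>P. pullback P (\<alpha> j) vs) differentiable (at P)" if "j \<le> N" for j vs P
    using parity[OF that] differentiable_pullback_bigraded_sum by blast
  have semi: "\<exists>s. pullback R (\<alpha> j) = (\<lambda>vs. s * \<alpha> j vs)" if "j \<le> N" for j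
    using parity[OF that]
  proof
    assume "\<alpha> j \<in> bigraded_sum W (d j) even"
    then have "pullback R (\<alpha> j) = (\<lambda>vs. 1 * \<alpha> j vs)"
      by (rule pullback_reflection_bigraded_sum[OF R]) simp
    then show ?thesis by blast
  next
    assume "\<alpha> j \<in> bigraded_sum W (d j) odd"
    then have "pullback R (\<alpha> j) = (\<lambda>vs. (- 1) * \<alpha> j vs)"
      by (rule pullback_reflection_bigraded_sum[OF R]) simp
    then show ?thesis by blast
  qed
  have conj: "R ** A ** R \<in> ?\<gg>" if "A \<in> ?\<gg>" for A
    by (rule lie_algebra_conjugate[OF that RR])
       (rule form_stabilizer_reflection_conjugate[OF _ sym RR semi])
  have inner_conj: "(R ** A ** R) \<bullet> B = A \<bullet> (R ** B ** R)" for A B :: "real^'n^'n"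
    using inner_matrix_mult_right[of "R ** A" R B] inner_matrix_mult_left[of R A "B ** R"]
    by (simp add: sym matrix_mul_assoc)
  have comm_conj: "B ** R = R ** B \<Longrightarrow> R ** B ** R = B" for B
    by (metis RR matrix_mul_assoc matrix_mul_rid)
  show "so_complement_in ?\<gg> ?\<hh> = {A \<in> ?\<gg>. two_form A \<in> bigraded W 1 1}"
  proof (intro equalityI subsetI)
    fix A assume "A \<in> {A \<in> ?\<gg>. two_form A \<in> bigraded W 1 1}"
    then have A: "A \<in> ?\<gg>" and anti: "R ** A ** R = - A"
      using anticommute_if_bigraded[OF R] by auto
    \<comment> \<open>Eigenvectors of the self-adjoint conjugation for the eigenvalues
      \<open>-1\<close> and \<open>1\<close> are orthogonal.\<close>
    have "A \<bullet> B = 0" if B: "B \<in> ?\<hh>" for B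
    proof -
      have "R ** B ** R = B"
        using lie_algebra_plane_stabilizer_commute[OF R orth B] comm_conj by blast
      then show ?thesis
        using inner_conj[of A B] anti by simp
    qed
    then show "A \<in> so_complement_in ?\<gg> ?\<hh>"
      using A by (simp add: so_complement_in_def so_inner_def)
  next
    fix A assume "A \<in> so_complement_in ?\<gg> ?\<hh>"
    then have A: "A \<in> ?\<gg>" and perp: "\<And>B. B \<in> ?\<hh> \<Longrightarrow> A \<bullet> B = 0"
      by (auto simp: so_complement_in_def so_inner_def)
    \<comment> \<open>\<open>B\<close> is twice the component of \<open>A\<close> fixed by
      conjugation. Without the factor one half, closure of the Lie algebra under addition puts
      \<open>B\<close> into it.\<close>
    define B where "B = A + R ** A ** R"
    have B: "B \<in> ?\<gg>"
      unfolding B_def by (intro lie_algebra_add A conj form_stabilizer_mult)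
    have RBR: "R ** B ** R = B"
      unfolding B_def
      by (simp add: matrix_mult.add_left matrix_mult.add_right matrix_mul_assoc RR)
         (simp add: RR add.commute flip: matrix_mul_assoc)
    then have comm: "B ** R = R ** B"
      by (metis RR matrix_mul_assoc matrix_mul_lid)
    have "B \<in> ?\<hh>"
    proof (rule matrix_exp_in_lie_algebra)
      show "matrix_exp B t \<in> plane_stabilizer ?G W" for t
        using matrix_exp_in_form_stabilizer[OF B diff] matrix_exp_commute[OF comm]
        by (simp add: plane_stabilizer_iff_commute[OF R orth])
    qed
    then have "A \<bullet> B = 0"
      by (rule perp)
    \<comment> \<open>Moving the conjugation onto the fixed \<open>B\<close> makes both summands
      equal to \<open>A \<bullet> B\<close>, which vanishes. Hence \<open>B = 0\<close>, that is,
      conjugation negates \<open>A\<close>.\<close>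
    moreover have "B \<bullet> B = A \<bullet> B + (R ** A ** R) \<bullet> B"
      by (metis B_def inner_add_left)
    ultimately have "B \<bullet> B = 0"
      by (simp add: inner_conj RBR)
    then have "R ** A ** R = - A"
      by (simp add: B_def eq_neg_iff_add_eq_0 add.commute)
    then have "two_form A \<in> bigraded W 1 1"
      using bigraded_if_anticommute[OF R es Rx] lie_algebra_skew[OF A orth] by blast
    then show "A \<in> {A \<in> ?\<gg>. two_form A \<in> bigraded W 1 1}"
      using A by blast
  qed
qed

end
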